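(* Let $i\ge2$. For $n\ge i+2+\frac{1-(-1)^i}{2}$, $H^A_i(\mathrm{IO}_n,\mathbb{Q})$ is non-trivial.
   Context: $F_n$ is the free group of rank $n$; $\mathrm{IO}_n$ is the kernel of the canonical surjection $\mathrm{Out}(F_n)\to\mathrm{GL}(n,\mathbb{Z})$. For a group $G$ with abelianization $\pi:G\to H_1(G,\mathbb{Z})$, the Albanese homology is $H^A_i(G,\mathbb{Q})=\mathrm{im}(\pi_*:H_i(G,\mathbb{Q})\to H_i(H_1(G,\mathbb{Z}),\mathbb{Q}))$. *)

theory Defs
  imports
    "HOL-Algebra.Algebra"
    "HOL-Library.Poly_Mapping"
    "Jordan_Normal_Form.Matrix"
begin

section \<open>Free groups\<close>

text \<open>The letter \<open>(s, True)\<close> is the generator \<open>s\<close>, the letter \<open>(s, False)\<close> its inverse.\<close>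

definition letter_inv :: "'a \<times> bool \<Rightarrow> 'a \<times> bool" where
  "letter_inv x = (fst x, \<not> snd x)"

definition reduced :: "('a \<times> bool) list \<Rightarrow> bool" where
  "reduced w \<longleftrightarrow> successively (\<lambda>x y. y \<noteq> letter_inv x) w"

text \<open>For a reduced word \<open>w\<close>, \<open>push x w\<close> is the reduced form of \<open>x # w\<close>; hence
  \<open>foldr push u v\<close> is the reduced form of the concatenation \<open>u @ v\<close>.\<close>

fun push :: "'a \<times> bool \<Rightarrow> ('a \<times> bool) list \<Rightarrow> ('a \<times> bool) list" where
  "push x [] = [x]"
| "push x (y # w) = (if y = letter_inv x then w else x # y # w)"

definition free_group :: "'a set \<Rightarrow> ('a \<times> bool) list monoid" where
  "free_group S =
     \<lparr>carrier = {w. fst ` set w \<subseteq> S \<and> reduced w}, monoid.mult = foldr push, one = []\<rparr>"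

lemma letter_inv_inv [simp]: "letter_inv (letter_inv x) = x"
  by (simp add: letter_inv_def)

lemma letter_inv_neq [simp]: "letter_inv x \<noteq> x" "x \<noteq> letter_inv x"
  by (cases x, simp add: letter_inv_def)+

lemma fst_letter_inv [simp]: "fst (letter_inv x) = fst x"
  by (simp add: letter_inv_def)

lemma reduced_Nil [simp]: "reduced []"
  by (simp add: reduced_def)

lemma reduced_single [simp]: "reduced [x]"
  by (simp add: reduced_def)

lemma reduced_ConsD: "reduced (x # w) \<Longrightarrow> reduced w"
  by (cases w) (auto simp: reduced_def)

lemma reduced_push: "reduced w \<Longrightarrow> reduced (push x w)"
  by (cases w) (auto simp: reduced_def dest: successively_Cons[THEN iffD1])

lemma push_eq_Cons: "reduced (x # w) \<Longrightarrow> push x w = x # w"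
  by (cases w) (auto simp: reduced_def)

lemma push_inv_push: "reduced w \<Longrightarrow> push (letter_inv x) (push x w) = w"
proof (cases w)
  case (Cons y w')
  assume "reduced w"
  then show ?thesis using Cons
    by (cases w') (auto simp: reduced_def)
qed simp

lemma push_push_inv: "reduced w \<Longrightarrow> push x (push (letter_inv x) w) = w"
  using push_inv_push[of w "letter_inv x"] by simp

lemma reduced_foldr_push: "reduced v \<Longrightarrow> reduced (foldr push u v)"
  by (induction u) (auto simp: reduced_push)

lemma foldr_push_push:
  "reduced w \<Longrightarrow> foldr push (push x u) w = push x (foldr push u w)"
  by (cases u) (auto simp: push_push_inv reduced_foldr_push)

lemma foldr_push_assoc:
  "reduced w \<Longrightarrow> foldr push (foldr push u v) w = foldr push u (foldr push v w)"
  by (induction u) (auto simp: foldr_push_push)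

lemma foldr_push_Nil: "reduced w \<Longrightarrow> foldr push w [] = w"
proof (induction w)
  case (Cons x w)
  then show ?case using reduced_ConsD[OF Cons.prems] by (simp add: push_eq_Cons)
qed simp

lemma foldr_push_inv: "reduced w \<Longrightarrow> foldr push (map letter_inv (rev w)) w = []"
proof (induction w)
  case (Cons x w)
  then show ?case using reduced_ConsD[OF Cons.prems] push_inv_push[of w x]
    by (simp add: push_eq_Cons)
qed simp

lemma reduced_inv: "reduced w \<Longrightarrow> reduced (map letter_inv (rev w))"
  by (auto simp: reduced_def successively_map intro: successively_mono)

lemma set_push: "set (push x w) \<subseteq> insert x (set w)"
  by (cases w) auto

lemma set_foldr_push: "set (foldr push u v) \<subseteq> set u \<union> set v"
proof (induction u)
  case (Cons x u)
  then show ?case using set_push[of x "foldr push u v"] by auto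
qed simp

lemma group_free_group: "group (free_group S)"
proof (rule groupI)
  fix u v assume "u \<in> carrier (free_group S)" "v \<in> carrier (free_group S)"
  then show "u \<otimes>\<^bsub>free_group S\<^esub> v \<in> carrier (free_group S)"
    using set_foldr_push[of u v] by (fastforce simp: free_group_def reduced_foldr_push)
next
  fix u assume "u \<in> carrier (free_group S)"
  then show "\<exists>v\<in>carrier (free_group S). v \<otimes>\<^bsub>free_group S\<^esub> u = \<one>\<^bsub>free_group S\<^esub>"
    by (intro bexI[of _ "map letter_inv (rev u)"])
       (auto simp: free_group_def foldr_push_inv reduced_inv image_image)
qed (auto simp: free_group_def foldr_push_assoc)

definition (in group) free_lift :: "('b \<Rightarrow> 'a) \<Rightarrow> ('b \<times> bool) list \<Rightarrow> 'a" where
  "free_lift f w = foldr (\<lambda>x y. (if snd x then f (fst x) else inv (f (fst x))) \<otimes> y) w \<one>"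

lemma (in group) free_lift:
  assumes f: "f \<in> S \<rightarrow> carrier G"
  shows "free_lift f \<in> hom (free_group S) G"
    and "s \<in> S \<Longrightarrow> free_lift f [(s, True)] = f s"
proof -
  have cl: "free_lift f w \<in> carrier G" if "fst ` set w \<subseteq> S" for w
    using that f by (induction w) (auto simp: free_lift_def Pi_iff)
  have push: "free_lift f (push x w) = (if snd x then f (fst x) else inv (f (fst x))) \<otimes> free_lift f w"
    if "fst x \<in> S" "fst ` set w \<subseteq> S" for x w
  proof (cases w)
    case (Cons y w')
    have "f (fst x) \<in> carrier G" "free_lift f w' \<in> carrier G"
      using that f cl[of w'] Cons by auto
    then show ?thesis using Cons
      by (auto simp: free_lift_def letter_inv_def m_assoc[symmetric])
  qed (simp add: free_lift_def)
  have "free_lift f (foldr push u v) = free_lift f u \<otimes> free_lift f v"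
    if "fst ` set u \<subseteq> S" "fst ` set v \<subseteq> S" for u v
    using that
  proof (induction u)
    case (Cons x u)
    have "fst ` set (foldr push u v) \<subseteq> S"
      using set_foldr_push[of u v] Cons.prems by fastforce
    moreover have "f (fst x) \<in> carrier G" "free_lift f u \<in> carrier G" "free_lift f v \<in> carrier G"
      using f Cons.prems cl[of u] cl[of v] by auto
    ultimately show ?case
      using Cons push[of x "foldr push u v"] by (auto simp: free_lift_def m_assoc)
  qed (use cl[of v] in \<open>simp add: free_lift_def\<close>)
  then show "free_lift f \<in> hom (free_group S) G"
    using cl by (auto simp: hom_def free_group_def)
  show "s \<in> S \<Longrightarrow> free_lift f [(s, True)] = f s"
    using f by (simp add: free_lift_def Pi_iff)
qed

lemma free_group_hom_unique:
  assumes G: "group G" and h: "h \<in> hom (free_group S) G" and k: "k \<in> hom (free_group S) G"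
    and eq: "\<And>s. s \<in> S \<Longrightarrow> h [(s, True)] = k [(s, True)]"
    and w: "w \<in> carrier (free_group S)"
  shows "h w = k w"
proof -
  interpret F: group "free_group S" by (rule group_free_group)
  interpret G: group G by (rule G)
  interpret h: group_hom "free_group S" G h by unfold_locales (rule h)
  interpret k: group_hom "free_group S" G k by unfold_locales (rule k)
  have letter: "[(s, b)] \<in> carrier (free_group S)" if "s \<in> S" for s b
    using that by (simp add: free_group_def)
  have inv: "[(s, False)] = inv\<^bsub>free_group S\<^esub> [(s, True)]" if "s \<in> S" for s
    by (rule F.inv_equality[symmetric])
       (use that in \<open>auto simp: letter, simp add: free_group_def letter_inv_def\<close>)
  have single: "h [x] = k [x]" if "fst x \<in> S" for x
    using that eq letter by (cases x; cases "snd x") (auto simp: inv)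
  show ?thesis using w
  proof (induction w)
    case Nil
    then show ?case using h.hom_one k.hom_one by (simp add: free_group_def)
  next
    case (Cons x w)
    then have w: "w \<in> carrier (free_group S)" and x: "fst x \<in> S"
      by (auto simp: free_group_def dest: reduced_ConsD)
    have "x # w = [x] \<otimes>\<^bsub>free_group S\<^esub> w"
      using Cons.prems by (simp add: free_group_def push_eq_Cons)
    then show ?case
      using Cons.IH[OF w] w single[OF x] letter[of "fst x" "snd x"] x by simp
  qed
qed


section \<open>Outer automorphisms\<close>

definition Inn :: "('a, 'b) monoid_scheme \<Rightarrow> ('a \<Rightarrow> 'a) set" where
  "Inn G = (\<lambda>g. \<lambda>x\<in>carrier G. g \<otimes>\<^bsub>G\<^esub> x \<otimes>\<^bsub>G\<^esub> inv\<^bsub>G\<^esub> g) ` carrier G"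

definition Out :: "('a, 'b) monoid_scheme \<Rightarrow> ('a \<Rightarrow> 'a) set monoid" where
  "Out G = AutoGroup G Mod Inn G"

lemma AutoGroup_simps:
  "carrier (AutoGroup G) = auto G"
  "\<one>\<^bsub>AutoGroup G\<^esub> = (\<lambda>x\<in>carrier G. x)"
  "f \<in> auto G \<Longrightarrow> g \<in> auto G \<Longrightarrow> f \<otimes>\<^bsub>AutoGroup G\<^esub> g = compose (carrier G) f g"
  by (auto simp: AutoGroup_def BijGroup_def auto_def)

lemma (in group) conj_hom_Auto:
  "(\<lambda>g. \<lambda>x\<in>carrier G. g \<otimes> x \<otimes> inv g) \<in> hom G (AutoGroup G)"
proof -
  let ?c = "\<lambda>g. \<lambda>x\<in>carrier G. g \<otimes> x \<otimes> inv g"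
  have auto: "?c g \<in> auto G" if g: "g \<in> carrier G" for g
  proof -
    have "?c g \<in> hom G G"
      using g by (auto simp: hom_def m_assoc inv_solve_left)
    moreover have "bij_betw (?c g) (carrier G) (carrier G)"
      by (rule bij_betwI[where g = "?c (inv g)"])
         (use g in \<open>auto simp: m_assoc, auto simp: m_assoc[symmetric]\<close>)
    ultimately show ?thesis by (simp add: auto_def Bij_def)
  qed
  show ?thesis
    by (rule homI)
       (auto simp: AutoGroup_simps auto, auto simp: compose_def fun_eq_iff m_assoc inv_mult_group)
qed

lemma (in group) Inn_normal: "Inn G \<lhd> AutoGroup G"
proof -
  let ?c = "\<lambda>g. \<lambda>x\<in>carrier G. g \<otimes> x \<otimes> inv g"
  interpret A: group "AutoGroup G" by (rule AutoGroup)
  interpret c: group_hom G "AutoGroup G" ?c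
    by unfold_locales (rule conj_hom_Auto)
  have sub: "subgroup (Inn G) (AutoGroup G)"
    unfolding Inn_def by (rule c.img_is_subgroup)
  have "f \<otimes>\<^bsub>AutoGroup G\<^esub> h \<otimes>\<^bsub>AutoGroup G\<^esub> inv\<^bsub>AutoGroup G\<^esub> f \<in> Inn G"
    if f: "f \<in> carrier (AutoGroup G)" and h: "h \<in> Inn G" for f h
  proof -
    obtain g where g: "g \<in> carrier G" and hg: "h = ?c g"
      using h by (auto simp: Inn_def)
    interpret f: group_hom G G f
      using f by unfold_locales (auto simp: AutoGroup_simps auto_def)
    have fA: "f \<in> auto G" and hA: "?c g \<in> auto G" and fgA: "?c (f g) \<in> auto G"
      using f g c.hom_closed by (auto simp: AutoGroup_simps)
    have "f \<otimes>\<^bsub>AutoGroup G\<^esub> ?c g = ?c (f g) \<otimes>\<^bsub>AutoGroup G\<^esub> f"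
      using g by (auto simp: AutoGroup_simps fA hA fgA compose_def fun_eq_iff)
    then have "f \<otimes>\<^bsub>AutoGroup G\<^esub> h \<otimes>\<^bsub>AutoGroup G\<^esub> inv\<^bsub>AutoGroup G\<^esub> f = ?c (f g)"
      using f fgA A.m_assoc[of "?c (f g)" f "inv\<^bsub>AutoGroup G\<^esub> f"] A.inv_closed[OF f] A.r_inv[OF f]
        A.r_one[of "?c (f g)"]
      by (simp only: hg AutoGroup_simps(1))
    then show ?thesis using g by (auto simp: Inn_def)
  qed
  with sub show ?thesis by (simp add: A.normal_inv_iff)
qed

lemma (in group) group_Out: "group (Out G)"
  unfolding Out_def by (rule normal.factorgroup_is_group[OF Inn_normal])


section \<open>The group \<open>IO\<close>\<close>

definition exponent_sum :: "'a \<Rightarrow> ('a \<times> bool) list \<Rightarrow> int" where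
  "exponent_sum s w = (\<Sum>x\<leftarrow>w. if fst x = s then (if snd x then 1 else - 1) else 0)"

text \<open>The matrix of the endomorphism of \<open>\<int>\<^sup>n\<close>, the abelianization of the free group of rank \<open>n\<close>,
  induced by \<open>\<phi>\<close>: column \<open>j\<close> lists the exponent sums of the image of the generator \<open>j\<close>.\<close>

definition abelianized_mat :: "nat \<Rightarrow> ((nat \<times> bool) list \<Rightarrow> (nat \<times> bool) list) \<Rightarrow> int mat" where
  "abelianized_mat n \<phi> = mat n n (\<lambda>(i, j). exponent_sum i (\<phi> [(j, True)]))"

definition GL_int :: "nat \<Rightarrow> int mat monoid" where
  "GL_int n = units_of (ring_mat TYPE(int) n ())"

text \<open>An outer automorphism is a coset of automorphisms all having the same matrix, cf. the lemma
  \<open>Out_to_GL_coset\<close> below.\<close>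

definition Out_to_GL ::
    "nat \<Rightarrow> ((nat \<times> bool) list \<Rightarrow> (nat \<times> bool) list) set \<Rightarrow> int mat" where
  "Out_to_GL n C = the_elem (abelianized_mat n ` C)"

definition IO :: "nat \<Rightarrow> ((nat \<times> bool) list \<Rightarrow> (nat \<times> bool) list) set monoid" where
  "IO n = (Out (free_group {..<n}))
     \<lparr>carrier := kernel (Out (free_group {..<n})) (GL_int n) (Out_to_GL n)\<rparr>"

lemma exponent_sum_simps [simp]:
  "exponent_sum s [] = 0"
  "exponent_sum s (x # w) = (if fst x = s then (if snd x then 1 else - 1) else 0) + exponent_sum s w"
  by (simp_all add: exponent_sum_def)

lemma exponent_sum_push:
  "exponent_sum s (push x w) =
     (if fst x = s then (if snd x then 1 else - 1) else 0) + exponent_sum s w"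
  by (cases w) (auto simp: letter_inv_def)

lemma exponent_sum_foldr_push:
  "exponent_sum s (foldr push u v) = exponent_sum s u + exponent_sum s v"
  by (induction u) (auto simp: exponent_sum_push)

lemma exponent_sum_hom: "exponent_sum s \<in> hom (free_group S) integer_group"
  by (auto simp: hom_def free_group_def exponent_sum_foldr_push)

lemma generator_in_free_group [simp]: "s \<in> S \<Longrightarrow> [(s, b)] \<in> carrier (free_group S)"
  by (simp add: free_group_def)

lemma exponent_sum_hom_apply:
  fixes n :: nat
  assumes \<phi>: "\<phi> \<in> hom (free_group {..<n}) (free_group {..<n})"
    and w: "w \<in> carrier (free_group {..<n})"
  shows "exponent_sum i (\<phi> w) = (\<Sum>k<n. exponent_sum i (\<phi> [(k, True)]) * exponent_sum k w)"
proof (rule free_group_hom_unique[OF group_integer_group _ _ _ w])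
  show "(\<lambda>w. exponent_sum i (\<phi> w)) \<in> hom (free_group {..<n}) integer_group"
    using hom_compose[OF \<phi> exponent_sum_hom[of i]] by (simp add: comp_def)
  show "(\<lambda>w. \<Sum>k<n. exponent_sum i (\<phi> [(k, True)]) * exponent_sum k w)
      \<in> hom (free_group {..<n}) integer_group"
    by (auto simp: hom_def free_group_def exponent_sum_foldr_push ring_distribs sum.distrib)
next
  fix s assume "s \<in> {..<n}"
  then have "exponent_sum i (\<phi> [(s, True)]) =
      (\<Sum>k<n. if k = s then exponent_sum i (\<phi> [(k, True)]) else 0)"
    by simp
  also have "\<dots> = (\<Sum>k<n. exponent_sum i (\<phi> [(k, True)]) * exponent_sum k [(s, True)])"
    by (rule sum.cong) auto
  finally show "exponent_sum i (\<phi> [(s, True)]) =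
      (\<Sum>k<n. exponent_sum i (\<phi> [(k, True)]) * exponent_sum k [(s, True)])" .
qed

lemma abelianized_mat_compose:
  assumes "\<phi> \<in> hom (free_group {..<n}) (free_group {..<n})"
    and "\<psi> \<in> hom (free_group {..<n}) (free_group {..<n})"
  shows "abelianized_mat n (compose (carrier (free_group {..<n})) \<phi> \<psi>)
    = abelianized_mat n \<phi> * abelianized_mat n \<psi>"
proof (rule eq_matI)
  fix i j assume "i < dim_row (abelianized_mat n \<phi> * abelianized_mat n \<psi>)"
    "j < dim_col (abelianized_mat n \<phi> * abelianized_mat n \<psi>)"
  then have ij: "i < n" "j < n" by (simp_all add: abelianized_mat_def)
  then have "\<psi> [(j, True)] \<in> carrier (free_group {..<n})"
    using assms(2) by (auto simp: hom_def Pi_iff)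
  from exponent_sum_hom_apply[OF assms(1) this, of i] ij
  show "abelianized_mat n (compose (carrier (free_group {..<n})) \<phi> \<psi>) $$ (i, j)
      = (abelianized_mat n \<phi> * abelianized_mat n \<psi>) $$ (i, j)"
    by (simp add: abelianized_mat_def compose_def scalar_prod_def atLeast0LessThan)
qed (simp_all add: abelianized_mat_def)

lemma abelianized_mat_id:
  "abelianized_mat n (\<lambda>x\<in>carrier (free_group {..<n}). x) = 1\<^sub>m n"
  by (rule eq_matI) (auto simp: abelianized_mat_def)

lemma abelianized_mat_hom:
  "abelianized_mat n \<in> hom (AutoGroup (free_group {..<n})) (GL_int n)"
proof -
  let ?F = "free_group {..<n}" and ?R = "ring_mat TYPE(int) n ()"
  interpret F: group ?F by (rule group_free_group)
  interpret A: group "AutoGroup ?F" by (rule F.AutoGroup)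
  have mult: "abelianized_mat n (\<phi> \<otimes>\<^bsub>AutoGroup ?F\<^esub> \<psi>) = abelianized_mat n \<phi> * abelianized_mat n \<psi>"
    if "\<phi> \<in> auto ?F" "\<psi> \<in> auto ?F" for \<phi> \<psi>
    using that abelianized_mat_compose[of \<phi> n \<psi>] by (simp add: AutoGroup_simps auto_def)
  have unit: "abelianized_mat n \<phi> \<in> Units ?R" if \<phi>: "\<phi> \<in> carrier (AutoGroup ?F)" for \<phi>
  proof -
    let ?\<psi> = "inv\<^bsub>AutoGroup ?F\<^esub> \<phi>"
    have \<psi>: "?\<psi> \<in> carrier (AutoGroup ?F)" using \<phi> by simp
    have "abelianized_mat n \<phi> * abelianized_mat n ?\<psi> = 1\<^sub>m n"
      "abelianized_mat n ?\<psi> * abelianized_mat n \<phi> = 1\<^sub>m n"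
      using mult[of \<phi> ?\<psi>] mult[of ?\<psi> \<phi>] \<phi> \<psi> A.r_inv[OF \<phi>] A.l_inv[OF \<phi>] abelianized_mat_id[of n]
      by (simp_all add: AutoGroup_simps(1,2))
    then show ?thesis
      by (auto simp: Units_def ring_mat_simps abelianized_mat_def
               intro!: bexI[of _ "abelianized_mat n ?\<psi>"])
  qed
  show ?thesis
    by (rule homI) (use unit mult in \<open>auto simp: GL_int_def units_of_def ring_mat_simps AutoGroup_simps(1)\<close>)
qed

lemma group_GL_int: "group (GL_int n)"
proof -
  interpret ring "ring_mat TYPE(int) n ()" by (rule ring_mat)
  show ?thesis unfolding GL_int_def by (rule units_group)
qed

lemma abelianized_mat_Inn:
  assumes "f \<in> Inn (free_group {..<n})"
  shows "abelianized_mat n f = 1\<^sub>m n"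
proof -
  let ?F = "free_group {..<n}"
  interpret F: group ?F by (rule group_free_group)
  obtain g where g: "g \<in> carrier ?F"
    and f: "f = (\<lambda>x\<in>carrier ?F. g \<otimes>\<^bsub>?F\<^esub> x \<otimes>\<^bsub>?F\<^esub> inv\<^bsub>?F\<^esub> g)"
    using assms by (auto simp: Inn_def)
  have "exponent_sum i (f x) = exponent_sum i x" if x: "x \<in> carrier ?F" for i x
  proof -
    interpret e: group_hom ?F integer_group "exponent_sum i"
      by (intro group_hom.intro group_hom_axioms.intro F.is_group group_integer_group exponent_sum_hom)
    have "exponent_sum i (g \<otimes>\<^bsub>?F\<^esub> inv\<^bsub>?F\<^esub> g) = 0"
      using g e.hom_one by simp
    then have "exponent_sum i g + exponent_sum i (inv\<^bsub>?F\<^esub> g) = 0"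
      using g by (simp del: F.r_inv)
    then show ?thesis using x g by (simp add: f)
  qed
  then show ?thesis
    by (intro eq_matI) (auto simp: abelianized_mat_def)
qed

lemma Out_to_GL_coset:
  assumes \<phi>: "\<phi> \<in> carrier (AutoGroup (free_group {..<n}))"
  shows "Out_to_GL n (Inn (free_group {..<n}) #>\<^bsub>AutoGroup (free_group {..<n})\<^esub> \<phi>)
    = abelianized_mat n \<phi>"
proof -
  let ?F = "free_group {..<n}"
  interpret F: group ?F by (rule group_free_group)
  interpret A: group "AutoGroup ?F" by (rule F.AutoGroup)
  interpret N: normal "Inn ?F" "AutoGroup ?F" by (rule F.Inn_normal)
  have "abelianized_mat n (f \<otimes>\<^bsub>AutoGroup ?F\<^esub> \<phi>) = abelianized_mat n \<phi>" if f: "f \<in> Inn ?F" for f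
    using hom_mult[OF abelianized_mat_hom N.mem_carrier[OF f] \<phi>] abelianized_mat_Inn[OF f]
    by (simp add: GL_int_def units_of_def ring_mat_simps abelianized_mat_def)
  then have "abelianized_mat n ` (Inn ?F #>\<^bsub>AutoGroup ?F\<^esub> \<phi>) = {abelianized_mat n \<phi>}"
    by (auto simp: r_coset_def image_iff) (use N.one_closed in blast)
  then show ?thesis by (simp add: Out_to_GL_def)
qed

lemma Out_to_GL_hom: "Out_to_GL n \<in> hom (Out (free_group {..<n})) (GL_int n)"
proof -
  let ?F = "free_group {..<n}"
  interpret F: group ?F by (rule group_free_group)
  interpret A: group "AutoGroup ?F" by (rule F.AutoGroup)
  interpret N: normal "Inn ?F" "AutoGroup ?F" by (rule F.Inn_normal)
  show ?thesis
    using abelianized_mat_hom[of n]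
    by (auto simp: hom_def Pi_iff Out_def FactGroup_def RCOSETS_def N.rcos_sum Out_to_GL_coset)
qed

lemma group_IO: "group (IO n)"
proof -
  let ?F = "free_group {..<n}"
  interpret F: group ?F by (rule group_free_group)
  interpret O: group "Out ?F" by (rule F.group_Out)
  interpret group_hom "Out ?F" "GL_int n" "Out_to_GL n"
    by (intro group_hom.intro group_hom_axioms.intro O.is_group group_GL_int Out_to_GL_hom)
  show ?thesis
    unfolding IO_def by (rule O.subgroup_imp_group[OF subgroup_kernel])
qed


section \<open>Rational group homology\<close>

text \<open>Homology with trivial coefficients, computed by the inhomogeneous bar complex. The list
  \<open>[g\<^sub>1, \<dots>, g\<^sub>n]\<close> stands for the basis element \<open>[g\<^sub>1|\<dots>|g\<^sub>n]\<close>. Its face with index \<open>j\<close> is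
  \<open>[g\<^sub>2|\<dots>|g\<^sub>n]\<close> for \<open>j = 0\<close>, \<open>[g\<^sub>1|\<dots>|g\<^sub>jg\<^sub>j\<^sub>+\<^sub>1|\<dots>|g\<^sub>n]\<close> for \<open>0 < j < n\<close>, and
  \<open>[g\<^sub>1|\<dots>|g\<^sub>n\<^sub>-\<^sub>1]\<close> for \<open>j = n\<close>.\<close>

definition bar_face :: "('a, 'b) monoid_scheme \<Rightarrow> nat \<Rightarrow> 'a list \<Rightarrow> 'a list" where
  "bar_face G j x =
     map (\<lambda>m. if m + 1 < j then x ! m else if m + 1 = j then x ! m \<otimes>\<^bsub>G\<^esub> x ! (m + 1) else x ! (m + 1))
       [0..<length x - 1]"

definition bar_chains :: "nat \<Rightarrow> ('a, 'b) monoid_scheme \<Rightarrow> ('a list \<Rightarrow>\<^sub>0 rat) set" where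
  "bar_chains n G = {c. Poly_Mapping.keys c \<subseteq> {x. length x = n \<and> set x \<subseteq> carrier G}}"

definition bar_boundary ::
    "nat \<Rightarrow> ('a, 'b) monoid_scheme \<Rightarrow> ('a list \<Rightarrow>\<^sub>0 rat) \<Rightarrow> ('a list \<Rightarrow>\<^sub>0 rat)" where
  "bar_boundary n G c =
     (if n = 0 then 0
      else \<Sum>x\<in>Poly_Mapping.keys c. \<Sum>j\<le>n.
             Poly_Mapping.single (bar_face G j x) ((- 1) ^ j * Poly_Mapping.lookup c x))"

definition bar_cycles :: "nat \<Rightarrow> ('a, 'b) monoid_scheme \<Rightarrow> ('a list \<Rightarrow>\<^sub>0 rat) set" where
  "bar_cycles n G = {c \<in> bar_chains n G. bar_boundary n G c = 0}"

definition bar_boundaries :: "nat \<Rightarrow> ('a, 'b) monoid_scheme \<Rightarrow> ('a list \<Rightarrow>\<^sub>0 rat) set" where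
  "bar_boundaries n G = bar_boundary (Suc n) G ` bar_chains (Suc n) G"

definition bar_cycle_group :: "nat \<Rightarrow> ('a, 'b) monoid_scheme \<Rightarrow> ('a list \<Rightarrow>\<^sub>0 rat) monoid" where
  "bar_cycle_group n G = \<lparr>carrier = bar_cycles n G, monoid.mult = (+), one = 0\<rparr>"

text \<open>The additive group of the rational vector space \<open>H\<^sub>n(G, \<rat>)\<close>.\<close>

definition group_homology :: "nat \<Rightarrow> ('a, 'b) monoid_scheme \<Rightarrow> ('a list \<Rightarrow>\<^sub>0 rat) set monoid" where
  "group_homology n G = bar_cycle_group n G Mod bar_boundaries n G"

definition bar_map :: "('a \<Rightarrow> 'c) \<Rightarrow> ('a list \<Rightarrow>\<^sub>0 rat) \<Rightarrow> ('c list \<Rightarrow>\<^sub>0 rat)" where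
  "bar_map f c =
     (\<Sum>x\<in>Poly_Mapping.keys c. Poly_Mapping.single (map f x) (Poly_Mapping.lookup c x))"

text \<open>The image of a class under \<open>bar_map f\<close> need not be a full class of \<open>H\<close>; adding the boundaries
  makes it one, cf. the lemma \<open>group_homology_map_coset\<close> below.\<close>

definition group_homology_map ::
    "nat \<Rightarrow> ('c, 'd) monoid_scheme \<Rightarrow> ('a \<Rightarrow> 'c) \<Rightarrow> ('a list \<Rightarrow>\<^sub>0 rat) set \<Rightarrow> ('c list \<Rightarrow>\<^sub>0 rat) set" where
  "group_homology_map n H f C = bar_boundaries n H <#>\<^bsub>bar_cycle_group n H\<^esub> (bar_map f ` C)"


lemma keys_sum_extend:
  fixes g :: "'a \<Rightarrow> 'b::zero \<Rightarrow> 'c::comm_monoid_add"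
  assumes "finite A" "Poly_Mapping.keys c \<subseteq> A" "\<And>x. g x 0 = 0"
  shows "(\<Sum>x\<in>Poly_Mapping.keys c. g x (Poly_Mapping.lookup c x)) =
    (\<Sum>x\<in>A. g x (Poly_Mapping.lookup c x))"
  using assms by (intro sum.mono_neutral_left) (auto simp: in_keys_iff)

lemma keys_sum_add:
  fixes g :: "'a \<Rightarrow> 'b::monoid_add \<Rightarrow> 'c::comm_monoid_add"
  assumes add: "\<And>x p q. g x (p + q) = g x p + g x q" and zero: "\<And>x. g x 0 = 0"
  shows "(\<Sum>x\<in>Poly_Mapping.keys (c + d). g x (Poly_Mapping.lookup (c + d) x)) =
    (\<Sum>x\<in>Poly_Mapping.keys c. g x (Poly_Mapping.lookup c x)) +
    (\<Sum>x\<in>Poly_Mapping.keys d. g x (Poly_Mapping.lookup d x))"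
proof -
  let ?A = "Poly_Mapping.keys c \<union> Poly_Mapping.keys d"
  show ?thesis
    using keys_sum_extend[of ?A "c + d" g, OF _ keys_add zero]
      keys_sum_extend[of ?A c g, OF _ Un_upper1 zero] keys_sum_extend[of ?A d g, OF _ Un_upper2 zero]
    by (simp add: lookup_add add sum.distrib)
qed

lemma bar_boundary_add: "bar_boundary n G (c + d) = bar_boundary n G c + bar_boundary n G d"
  unfolding bar_boundary_def
  by (subst keys_sum_add) (auto simp: single_add sum.distrib ring_distribs)

lemma bar_map_add: "bar_map f (c + d) = bar_map f c + bar_map f d"
  unfolding bar_map_def by (subst keys_sum_add) (auto simp: single_add)

lemma bar_boundary_zero [simp]: "bar_boundary n G 0 = 0"
  by (simp add: bar_boundary_def)

lemma bar_map_zero [simp]: "bar_map f 0 = 0"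
  by (simp add: bar_map_def)

lemma bar_boundary_sum: "bar_boundary n G (sum h A) = (\<Sum>a\<in>A. bar_boundary n G (h a))"
  by (induction A rule: infinite_finite_induct) (auto simp: bar_boundary_add)

lemma bar_map_sum: "bar_map f (sum h A) = (\<Sum>a\<in>A. bar_map f (h a))"
  by (induction A rule: infinite_finite_induct) (auto simp: bar_map_add)

lemma bar_boundary_uminus: "bar_boundary n G (- c) = - bar_boundary n G c"
  using bar_boundary_add[of n G c "- c"] by (simp add: eq_neg_iff_add_eq_0 add.commute)

lemma bar_map_uminus: "bar_map f (- c) = - bar_map f c"
  using bar_map_add[of f c "- c"] by (simp add: eq_neg_iff_add_eq_0 add.commute)

lemma bar_boundary_single:
  "n > 0 \<Longrightarrow> bar_boundary n G (Poly_Mapping.single x q) =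
    (\<Sum>j\<le>n. Poly_Mapping.single (bar_face G j x) ((- 1) ^ j * q))"
  by (simp add: bar_boundary_def)

lemma bar_map_single [simp]:
  "bar_map f (Poly_Mapping.single x q) = Poly_Mapping.single (map f x) q"
  by (simp add: bar_map_def)

lemma poly_mapping_sum_single:
  "c = (\<Sum>x\<in>Poly_Mapping.keys c. Poly_Mapping.single x (Poly_Mapping.lookup c x))"
  by (rule poly_mapping_eqI)
     (auto simp: lookup_sum lookup_single when_def in_keys_iff)

lemma bar_chains_zero [simp]: "0 \<in> bar_chains n G"
  by (simp add: bar_chains_def)

lemma bar_chains_add: "c \<in> bar_chains n G \<Longrightarrow> d \<in> bar_chains n G \<Longrightarrow> c + d \<in> bar_chains n G"
  using keys_add[of c d] by (simp add: bar_chains_def) blast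

lemma bar_chains_uminus: "c \<in> bar_chains n G \<Longrightarrow> - c \<in> bar_chains n G"
  by (simp add: bar_chains_def)

lemma bar_chains_sum: "(\<And>a. a \<in> A \<Longrightarrow> h a \<in> bar_chains n G) \<Longrightarrow> sum h A \<in> bar_chains n G"
  by (induction A rule: infinite_finite_induct) (auto simp: bar_chains_add)

lemma bar_chains_single:
  "length x = n \<Longrightarrow> set x \<subseteq> carrier G \<Longrightarrow> Poly_Mapping.single x q \<in> bar_chains n G"
  by (simp add: bar_chains_def)

lemma length_bar_face [simp]: "length (bar_face G j x) = length x - 1"
  by (simp add: bar_face_def)

context group
begin

lemma bar_face_closed: "set x \<subseteq> carrier G \<Longrightarrow> set (bar_face G j x) \<subseteq> carrier G"
  by (auto simp: bar_face_def subset_iff intro!: m_closed)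

lemma bar_boundary_closed:
  assumes "c \<in> bar_chains (Suc n) G"
  shows "bar_boundary (Suc n) G c \<in> bar_chains n G"
  using assms bar_face_closed
  by (auto simp: bar_boundary_def bar_chains_def[of "Suc n"] subset_iff
           simp del: sum.atMost_Suc intro!: bar_chains_sum bar_chains_single)

lemma bar_face_face:
  assumes "set x \<subseteq> carrier G" "k < j"
  shows "bar_face G k (bar_face G j x) = bar_face G (j - 1) (bar_face G k x)"
proof (rule nth_equalityI)
  fix m assume "m < length (bar_face G k (bar_face G j x))"
  then have m: "m + 2 < length x" by simp
  then have "x ! m \<in> carrier G" "x ! (m + 1) \<in> carrier G" "x ! (m + 2) \<in> carrier G"
    using assms(1) by (auto simp: subset_iff)
  then show "bar_face G k (bar_face G j x) ! m = bar_face G (j - 1) (bar_face G k x) ! m"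
    using m assms(2) by (auto simp: bar_face_def m_assoc)
qed simp

lemma bar_boundary_boundary:
  assumes "c \<in> bar_chains (Suc n) G"
  shows "bar_boundary n G (bar_boundary (Suc n) G c) = 0"
proof (cases "n = 0")
  case False
  have *: "bar_boundary n G (bar_boundary (Suc n) G (Poly_Mapping.single x q)) = 0"
    if x: "set x \<subseteq> carrier G" for x q
  proof -
    let ?s = "\<lambda>(j, k). Poly_Mapping.single (bar_face G k (bar_face G j x)) ((- 1) ^ (k + j) * q)"
    let ?A = "{(j, k). k < j \<and> j \<le> Suc n}" and ?B = "{(j, k). j \<le> k \<and> k \<le> n}"
    have fin: "finite ?A" "finite ?B"
      by (rule finite_subset[of _ "{..Suc n} \<times> {..Suc n}"]; auto)+
    have "bar_boundary n G (bar_boundary (Suc n) G (Poly_Mapping.single x q)) =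
        (\<Sum>j\<le>Suc n. \<Sum>k\<le>n. ?s (j, k))"
      using False
      by (simp add: bar_boundary_single bar_boundary_sum power_add mult.assoc del: sum.atMost_Suc)
    also have "\<dots> = sum ?s ({..Suc n} \<times> {..n})"
      by (simp add: sum.cartesian_product)
    also have "\<dots> = sum ?s ?A + sum ?s ?B"
    proof -
      have "{..Suc n} \<times> {..n} = ?A \<union> ?B" by auto
      moreover have "?A \<inter> ?B = {}" by auto
      ultimately show ?thesis using sum.union_disjoint[OF fin, of ?s] by (simp only:)
    qed
    also have "sum ?s ?A = (\<Sum>p\<in>?B. - ?s p)"
    proof (rule sum.reindex_bij_witness[where i = "\<lambda>(j, k). (Suc k, j)" and j = "\<lambda>(j, k). (k, j - 1)"])
      fix p assume "p \<in> ?A"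
      then obtain j k where p: "p = (Suc j, k)" and "k \<le> j"
        by (cases p; cases "fst p") auto
      then show "- ?s ((\<lambda>(j, k). (k, j - 1)) p) = ?s p"
        using bar_face_face[OF x, of k "Suc j"]
        by (simp add: single_uminus[symmetric] add.commute)
    qed auto
    finally show ?thesis by (simp add: sum_negf)
  qed
  show ?thesis
    by (subst poly_mapping_sum_single[of c])
       (use assms * in \<open>auto simp: bar_boundary_sum bar_chains_def intro!: sum.neutral\<close>)
qed (simp add: bar_boundary_def)

lemma group_bar_cycle_group: "comm_group (bar_cycle_group n G)"
proof (rule comm_groupI)
  fix c assume "c \<in> carrier (bar_cycle_group n G)"
  then show "\<exists>d\<in>carrier (bar_cycle_group n G).
      d \<otimes>\<^bsub>bar_cycle_group n G\<^esub> c = \<one>\<^bsub>bar_cycle_group n G\<^esub>"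
    by (intro bexI[of _ "- c"])
       (auto simp: bar_cycle_group_def bar_cycles_def bar_chains_uminus bar_boundary_uminus)
qed (auto simp: bar_cycle_group_def bar_cycles_def bar_chains_add bar_boundary_add add_ac)

lemma bar_boundaries_normal: "bar_boundaries n G \<lhd> bar_cycle_group n G"
proof -
  interpret Z: comm_group "bar_cycle_group n G" by (rule group_bar_cycle_group)
  have "inv\<^bsub>bar_cycle_group n G\<^esub> c = - c" if "c \<in> carrier (bar_cycle_group n G)" for c
    by (rule Z.inv_equality)
       (use that in \<open>auto simp: bar_cycle_group_def bar_cycles_def bar_chains_uminus bar_boundary_uminus\<close>)
  moreover have sub: "bar_boundaries n G \<subseteq> carrier (bar_cycle_group n G)"
    using bar_boundary_closed bar_boundary_boundary
    by (auto simp: bar_boundaries_def bar_cycle_group_def bar_cycles_def)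
  ultimately have inv: "inv\<^bsub>bar_cycle_group n G\<^esub> c = - c" if "c \<in> bar_boundaries n G" for c
    using that by blast
  have "subgroup (bar_boundaries n G) (bar_cycle_group n G)"
  proof (rule Z.subgroupI[OF sub])
    show "bar_boundaries n G \<noteq> {}"
      unfolding bar_boundaries_def using bar_chains_zero[of "Suc n" G] by blast
    show "inv\<^bsub>bar_cycle_group n G\<^esub> c \<in> bar_boundaries n G" if "c \<in> bar_boundaries n G" for c
      using that by (auto simp: inv, auto simp: bar_boundaries_def image_iff
        bar_boundary_uminus[symmetric] intro: bar_chains_uminus)
    show "c \<otimes>\<^bsub>bar_cycle_group n G\<^esub> d \<in> bar_boundaries n G"
      if "c \<in> bar_boundaries n G" "d \<in> bar_boundaries n G" for c d
      using that by (auto simp: bar_boundaries_def bar_cycle_group_def image_iff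
        bar_boundary_add[symmetric] intro: bar_chains_add)
  qed
  then show ?thesis by (rule Z.subgroup_imp_normal)
qed

lemma group_homology_group: "group (group_homology n G)"
  unfolding group_homology_def by (rule normal.factorgroup_is_group[OF bar_boundaries_normal])

end

context group_hom
begin

lemma bar_map_chains: "c \<in> bar_chains n G \<Longrightarrow> bar_map h c \<in> bar_chains n H"
  by (auto simp: bar_map_def bar_chains_def[of _ G] subset_iff
           intro!: bar_chains_sum bar_chains_single)

lemma bar_map_face:
  "set x \<subseteq> carrier G \<Longrightarrow> map h (bar_face G j x) = bar_face H j (map h x)"
  by (rule nth_equalityI) (auto simp: bar_face_def subset_iff)

lemma bar_map_boundary:
  assumes "c \<in> bar_chains n G"
  shows "bar_map h (bar_boundary n G c) = bar_boundary n H (bar_map h c)"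
proof (cases "n = 0")
  case False
  have *: "bar_map h (bar_boundary n G (Poly_Mapping.single x q)) =
      bar_boundary n H (bar_map h (Poly_Mapping.single x q))" if "set x \<subseteq> carrier G" for x q
    using that False by (simp add: bar_boundary_single bar_map_sum bar_map_face)
  show ?thesis
    by (subst (1 2) poly_mapping_sum_single[of c])
       (use assms * in \<open>auto simp: bar_boundary_sum bar_map_sum bar_chains_def subset_iff
          simp del: bar_map_single intro!: sum.cong\<close>)
qed (simp add: bar_boundary_def)

lemma bar_map_cycles: "c \<in> bar_cycles n G \<Longrightarrow> bar_map h c \<in> bar_cycles n H"
  using bar_map_boundary[of c n] by (auto simp: bar_cycles_def bar_map_chains)

lemma bar_map_boundaries: "c \<in> bar_boundaries n G \<Longrightarrow> bar_map h c \<in> bar_boundaries n H"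
  by (auto simp: bar_boundaries_def bar_map_boundary bar_map_chains)

lemma group_homology_map_coset:
  assumes "c \<in> bar_cycles n G"
  shows "group_homology_map n H h (bar_boundaries n G #>\<^bsub>bar_cycle_group n G\<^esub> c)
    = bar_boundaries n H #>\<^bsub>bar_cycle_group n H\<^esub> bar_map h c"
proof -
  have add: "b + b' \<in> bar_boundaries n H"
    if "b \<in> bar_boundaries n H" "b' \<in> bar_boundaries n H" for b b'
    using normal_imp_subgroup[OF H.bar_boundaries_normal[of n], THEN subgroup.m_closed, OF that]
    by (simp add: bar_cycle_group_def)
  have zero: "0 \<in> bar_boundaries n G"
    using normal_imp_subgroup[OF G.bar_boundaries_normal[of n], THEN subgroup.one_closed]
    by (simp add: bar_cycle_group_def)
  show ?thesis
    unfolding group_homology_map_def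
  proof (intro equalityI subsetI)
    fix d assume "d \<in> bar_boundaries n H <#>\<^bsub>bar_cycle_group n H\<^esub>
      bar_map h ` (bar_boundaries n G #>\<^bsub>bar_cycle_group n G\<^esub> c)"
    then obtain b b' where "b \<in> bar_boundaries n H" "b' \<in> bar_boundaries n G"
        "d = b + bar_map h (b' + c)"
      by (auto simp: set_mult_def r_coset_def bar_cycle_group_def)
    then show "d \<in> bar_boundaries n H #>\<^bsub>bar_cycle_group n H\<^esub> bar_map h c"
      using add[of b "bar_map h b'"] bar_map_boundaries[of b' n]
      by (auto simp: r_coset_def bar_cycle_group_def bar_map_add add.assoc[symmetric])
  next
    fix d assume "d \<in> bar_boundaries n H #>\<^bsub>bar_cycle_group n H\<^esub> bar_map h c"
    then obtain b where "b \<in> bar_boundaries n H" "d = b + bar_map h (0 + c)"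
      by (auto simp: r_coset_def bar_cycle_group_def)
    then show "d \<in> bar_boundaries n H <#>\<^bsub>bar_cycle_group n H\<^esub>
      bar_map h ` (bar_boundaries n G #>\<^bsub>bar_cycle_group n G\<^esub> c)"
      using zero by (force simp: set_mult_def r_coset_def bar_cycle_group_def)
  qed
qed

lemma group_homology_map_hom:
  "group_homology_map n H h \<in> hom (group_homology n G) (group_homology n H)"
proof -
  interpret NG: normal "bar_boundaries n G" "bar_cycle_group n G" by (rule G.bar_boundaries_normal)
  interpret NH: normal "bar_boundaries n H" "bar_cycle_group n H" by (rule H.bar_boundaries_normal)
  have carr: "carrier (bar_cycle_group n K) = bar_cycles n K" for K :: "('x, 'y) monoid_scheme"
    by (simp add: bar_cycle_group_def)
  have coset: "group_homology_map n H h (bar_boundaries n G #>\<^bsub>bar_cycle_group n G\<^esub> c)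
      = bar_boundaries n H #>\<^bsub>bar_cycle_group n H\<^esub> bar_map h c"
    if "c \<in> carrier (bar_cycle_group n G)" for c
    using that by (simp add: group_homology_map_coset carr)
  have "bar_map h \<in> hom (bar_cycle_group n G) (bar_cycle_group n H)"
    by (auto simp: hom_def bar_cycle_group_def bar_map_add bar_map_cycles)
  then show ?thesis
    by (auto simp: hom_def Pi_iff group_homology_def FactGroup_def RCOSETS_def
          NG.rcos_sum NH.rcos_sum coset)
qed

end


section \<open>Albanese homology\<close>

definition abelianization :: "('a, 'b) monoid_scheme \<Rightarrow> 'a set monoid" where
  "abelianization G = G Mod derived G (carrier G)"

definition abelianization_map :: "('a, 'b) monoid_scheme \<Rightarrow> 'a \<Rightarrow> 'a set" where
  "abelianization_map G g = derived G (carrier G) #>\<^bsub>G\<^esub> g"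

definition albanese_homology ::
    "nat \<Rightarrow> ('a, 'b) monoid_scheme \<Rightarrow> ('a set list \<Rightarrow>\<^sub>0 rat) set monoid" where
  "albanese_homology n G = (group_homology n (abelianization G))
     \<lparr>carrier := group_homology_map n (abelianization G) (abelianization_map G)
                  ` carrier (group_homology n G)\<rparr>"

lemma (in group) group_hom_abelianization:
  "group_hom G (abelianization G) (abelianization_map G)"
proof -
  interpret N: normal "derived G (carrier G)" G by (rule derived_self_is_normal)
  have "abelianization_map G \<in> hom G (abelianization G)"
    using N.r_coset_hom_Mod by (simp add: abelianization_map_def[abs_def] abelianization_def)
  then show ?thesis
    by (intro group_hom.intro group_hom_axioms.intro is_group)
       (simp_all add: abelianization_def derived_quot_is_group)
qed

lemma (in group) group_albanese_homology: "group (albanese_homology n G)"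
proof -
  interpret ab: group_hom G "abelianization G" "abelianization_map G"
    by (rule group_hom_abelianization)
  interpret group_hom "group_homology n G" "group_homology n (abelianization G)"
      "group_homology_map n (abelianization G) (abelianization_map G)"
    by (intro group_hom.intro group_hom_axioms.intro group_homology_group
          ab.H.group_homology_group ab.group_homology_map_hom)
  show ?thesis
    unfolding albanese_homology_def by (rule H.subgroup_imp_group[OF img_is_subgroup])
qed

end

theory Submission
  imports Defs "HOL-Combinatorics.Permutations"
begin

text \<open>The partial conjugations \<open>x\<^sub>j \<mapsto> x\<^sub>0 x\<^sub>j x\<^sub>0\<inverse>\<close> for \<open>1 \<le> j \<le> n - 2\<close> commute, and their
  classes in \<open>IO n\<close> are dual to homomorphisms to the integers: the coefficient of \<open>X\<^sub>0 X\<^sub>j\<close> in the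
  Magnus expansion of the image of \<open>x\<^sub>j\<close>, minus the corresponding coefficient for \<open>n - 1\<close> (a
  Johnson homomorphism). Any \<open>i\<close> of these classes span an abelian cycle, on whose image in the
  homology of the abelianization the cup product of the dual homomorphisms takes the value \<open>1\<close>.\<close>

section \<open>Cup products of integer-valued homomorphisms on bar chains\<close>

text \<open>Up to a conventional sign, this is the pairing of a chain with the cup product of the
  degree-one cochains \<open>\<phi> 0\<close>, ..., \<open>\<phi> (n - 1)\<close>: the bar complex
  multiplies their values entry by entry.\<close>

definition cup_eval :: "nat \<Rightarrow> (nat \<Rightarrow> 'a \<Rightarrow> int) \<Rightarrow> ('a list \<Rightarrow>\<^sub>0 rat) \<Rightarrow> rat" where
  "cup_eval n \<phi> c =
     (\<Sum>x\<in>Poly_Mapping.keys c. Poly_Mapping.lookup c x * (\<Prod>k<n. of_int (\<phi> k (x ! k))))"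

lemma cup_eval_zero [simp]: "cup_eval n \<phi> 0 = 0"
  by (simp add: cup_eval_def)

lemma cup_eval_add: "cup_eval n \<phi> (c + d) = cup_eval n \<phi> c + cup_eval n \<phi> d"
  unfolding cup_eval_def by (rule keys_sum_add) (auto simp: ring_distribs)

lemma cup_eval_sum: "cup_eval n \<phi> (sum h A) = (\<Sum>a\<in>A. cup_eval n \<phi> (h a))"
  by (induction A rule: infinite_finite_induct) (auto simp: cup_eval_add)

lemma cup_eval_single [simp]:
  "cup_eval n \<phi> (Poly_Mapping.single x q) = q * (\<Prod>k<n. of_int (\<phi> k (x ! k)))"
  by (simp add: cup_eval_def)

lemma nth_bar_face:
  "m < length x - 1 \<Longrightarrow> bar_face G j x ! m =
     (if m + 1 < j then x ! m else if m + 1 = j then x ! m \<otimes>\<^bsub>G\<^esub> x ! (m + 1) else x ! (m + 1))"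
  by (simp add: bar_face_def)

lemma cup_eval_boundary_single:
  assumes \<phi>: "\<And>k. k < n \<Longrightarrow> \<phi> k \<in> hom G integer_group"
    and x: "length x = Suc n" "set x \<subseteq> carrier G"
  shows "cup_eval n \<phi> (bar_boundary (Suc n) G (Poly_Mapping.single x q)) = 0"
proof -
  \<comment> \<open>The \<open>j\<close>-th face contributes \<open>T (j - 1) + T j\<close>, so the alternating sum telescopes.\<close>
  define P where "P j = (\<Prod>k<n. rat_of_int (\<phi> k (bar_face G j x ! k)))" for j
  \<comment> \<open>\<open>T m\<close> belongs to the tuple with entry \<open>m\<close> deleted. An
    inner face merges two neighbours, and additivity of \<open>\<phi> m\<close> splits its product
    into the deletions of either one.\<close>
  define T where "T m = (\<Prod>k<n. rat_of_int (\<phi> k (if k < m then x ! k else x ! (k + 1))))" for m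
  have P_0: "P 0 = T 0" and P_last: "P (Suc n) = T n"
    using x by (auto simp: P_def T_def nth_bar_face intro!: prod.cong)
  have P_Suc: "P (Suc m) = T m + T (Suc m)" if m: "m < n" for m
  proof -
    have split: "prod f {..<n} = f m * prod f ({..<n} - {m})" for f :: "nat \<Rightarrow> rat"
      using m by (intro prod.remove) auto
    have in_carrier: "x ! m \<in> carrier G" "x ! (m + 1) \<in> carrier G"
      using x m by (auto simp: subset_iff)
    let ?R = "\<Prod>k\<in>{..<n} - {m}. rat_of_int (\<phi> k (if k < m then x ! k else x ! (k + 1)))"
    have "P (Suc m) = (\<Prod>k<n. rat_of_int (\<phi> k (if k < m then x ! k
        else if k = m then x ! m \<otimes>\<^bsub>G\<^esub> x ! (m + 1) else x ! (k + 1))))"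
      using x by (auto simp: P_def nth_bar_face intro!: prod.cong)
    also have "\<dots> = rat_of_int (\<phi> m (x ! m \<otimes>\<^bsub>G\<^esub> x ! (m + 1))) * ?R"
      by (subst split, rule arg_cong2[where f = "(*)"], simp, rule prod.cong) simp_all
    also have "rat_of_int (\<phi> m (x ! m \<otimes>\<^bsub>G\<^esub> x ! (m + 1)))
        = rat_of_int (\<phi> m (x ! m)) + rat_of_int (\<phi> m (x ! (m + 1)))"
      using hom_mult[OF \<phi>[OF m] in_carrier] by simp
    also have "rat_of_int (\<phi> m (x ! m)) * ?R = T (Suc m)"
      unfolding T_def
      by (subst split, rule arg_cong2[where f = "(*)"], simp, rule prod.cong) simp_all
    moreover have "rat_of_int (\<phi> m (x ! (m + 1))) * ?R = T m"
      unfolding T_def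
      by (subst split, rule arg_cong2[where f = "(*)"], simp, rule prod.cong) simp_all
    ultimately show ?thesis by (simp add: ring_distribs)
  qed
  have telescope: "(\<Sum>j\<le>m. (- 1) ^ j * P j) = (- 1) ^ m * T m" if "m \<le> n" for m
    using that by (induction m) (auto simp: P_0 P_Suc algebra_simps)
  have "(\<Sum>j\<le>Suc n. (- 1) ^ j * P j) = 0"
    using telescope[of n] by (simp add: P_last)
  moreover have "cup_eval n \<phi> (bar_boundary (Suc n) G (Poly_Mapping.single x q))
      = q * (\<Sum>j\<le>Suc n. (- 1) ^ j * P j)"
    unfolding P_def sum_distrib_left
    by (simp add: bar_boundary_single cup_eval_sum mult_ac del: sum.atMost_Suc)
  ultimately show ?thesis by simp
qed

text \<open>A cup product of homomorphisms is a cocycle, so its value on a cycle depends only on the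
  homology class.\<close>

lemma cup_eval_boundaries:
  assumes "\<And>k. k < n \<Longrightarrow> \<phi> k \<in> hom G integer_group" and "c \<in> bar_boundaries n G"
  shows "cup_eval n \<phi> c = 0"
proof -
  obtain d where c: "c = bar_boundary (Suc n) G d" and d: "d \<in> bar_chains (Suc n) G"
    using assms(2) by (auto simp: bar_boundaries_def)
  show ?thesis
    unfolding c
    by (subst poly_mapping_sum_single[of d])
       (use d cup_eval_boundary_single[of n, OF assms(1)] in \<open>auto simp: bar_boundary_sum cup_eval_sum bar_chains_def intro!: sum.neutral\<close>)
qed

section \<open>Abelian cycles of commuting elements\<close>

text \<open>The signed sum over all orders is the shuffle product of the one-cells
  \<open>[g k]\<close>. For commuting \<open>g k\<close> it represents the image of the fundamental
  class of the \<open>n\<close>-torus under the induced map from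
  \<open>\<int>\<^sup>n\<close>.\<close>

definition abelian_cycle :: "nat \<Rightarrow> (nat \<Rightarrow> 'a) \<Rightarrow> ('a list \<Rightarrow>\<^sub>0 rat)" where
  "abelian_cycle n g =
     (\<Sum>p | p permutes {..<n}. Poly_Mapping.single (map (g \<circ> p) [0..<n]) (of_int (sign p)))"

lemma bar_map_abelian_cycle: "bar_map f (abelian_cycle n g) = abelian_cycle n (f \<circ> g)"
  by (simp add: abelian_cycle_def bar_map_sum comp_assoc)

text \<open>In general the value is the determinant of the matrix \<open>\<phi> k (g l)\<close>. For
  the identity matrix, any permutation with a moved point \<open>k\<close> contributes a zero
  factor.\<close>

lemma cup_eval_abelian_cycle:
  assumes "\<And>k l. k < n \<Longrightarrow> l < n \<Longrightarrow> \<phi> k (g l) = (if k = l then 1 else 0)"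
  shows "cup_eval n \<phi> (abelian_cycle n g) = 1"
proof -
  have "(\<Prod>k<n. rat_of_int (\<phi> k (map (g \<circ> p) [0..<n] ! k))) = (if p = id then 1 else 0)"
    if p: "p permutes {..<n}" for p
  proof -
    have eq: "(\<Prod>k<n. rat_of_int (\<phi> k (map (g \<circ> p) [0..<n] ! k))) = (\<Prod>k<n. if k = p k then 1 else 0)"
      using assms permutes_in_image[OF p] by (intro prod.cong) auto
    show ?thesis
    proof (cases "p = id")
      case False
      then obtain k where "p k \<noteq> k" by (auto simp: fun_eq_iff)
      then have "k < n" "k \<noteq> p k" using p by (auto simp: permutes_def)
      then show ?thesis
        unfolding eq using False by (auto intro!: prod_zero bexI[of _ k])
    qed (unfold eq, simp)
  qed
  then have "cup_eval n \<phi> (abelian_cycle n g)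
      = (\<Sum>p | p permutes {..<n}. if p = id then 1 else 0)"
    by (auto simp: abelian_cycle_def cup_eval_sum simp del: nth_map intro!: sum.cong)
  also have "\<dots> = 1"
    by (simp add: permutes_id finite_permutations)
  finally show ?thesis .
qed

text \<open>Precomposition with this \<open>(m + 1)\<close>-cycle moves the first entry of a tuple
  to the end, so that dropping the last entry becomes dropping the first.\<close>

definition rotation :: "nat \<Rightarrow> nat \<Rightarrow> nat" where
  "rotation m k = (if k < m then k + 1 else if k = m then 0 else k)"

text \<open>The cycle is a product of \<open>m\<close> adjacent transpositions, one being split off
  in each induction step.\<close>

lemma rotation: "rotation m permutes {..m}" "sign (rotation m) = (- 1) ^ m"
proof (induction m)
  case 0
  have "rotation 0 = id" by (auto simp: rotation_def)
  then show "rotation 0 permutes {..0}" "sign (rotation 0) = (- 1) ^ 0" by auto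
next
  case (Suc m)
  have eq: "rotation (Suc m) = rotation m \<circ> transpose m (Suc m)"
    by (auto simp: rotation_def transpose_def)
  have swap: "transpose m (Suc m) permutes {..Suc m}"
    by (rule permutes_swap_id) auto
  have rot: "rotation m permutes {..Suc m}"
    by (rule permutes_subset[OF Suc(1)]) auto
  then show "rotation (Suc m) permutes {..Suc m}"
    unfolding eq using swap by (intro permutes_compose)
  show "sign (rotation (Suc m)) = (- 1) ^ Suc m"
    unfolding eq using Suc(2) sign_compose[of "rotation m" "transpose m (Suc m)"]
      permutation_permutes[of "rotation m"] permutation_permutes[of "transpose m (Suc m)"] rot swap
    by (auto simp: sign_swap_id)
qed

lemma (in group) abelian_cycle_cycles:
  assumes g: "\<And>k. k < n \<Longrightarrow> g k \<in> carrier G"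
    and comm: "\<And>k l. k < n \<Longrightarrow> l < n \<Longrightarrow> g k \<otimes> g l = g l \<otimes> g k"
  shows "abelian_cycle n g \<in> bar_cycles n G"
proof -
  define S where "S j = (\<Sum>p | p permutes {..<n}.
      Poly_Mapping.single (bar_face G j (map (g \<circ> p) [0..<n])) ((- 1) ^ j * rat_of_int (sign p)))" for j
  have sign_comp: "sign (p \<circ> q) = sign p * sign q" if "p permutes {..<n}" "q permutes {..<n}" for p q
    using that by (intro sign_compose) (auto simp: permutation_permutes)
  \<comment> \<open>Inner faces cancel along adjacent transpositions, the two outer faces along a rotation.\<close>
  have mid: "S (Suc j) = 0" if j: "Suc j < n" for j
  proof -
    let ?t = "transpose j (Suc j)"
    have t: "?t permutes {..<n}" using j by (intro permutes_swap_id) auto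
    have "bar_face G (Suc j) (map (g \<circ> (p \<circ> ?t)) [0..<n]) = bar_face G (Suc j) (map (g \<circ> p) [0..<n])"
      if p: "p permutes {..<n}" for p
    proof (rule nth_equalityI)
      fix m assume "m < length (bar_face G (Suc j) (map (g \<circ> (p \<circ> ?t)) [0..<n]))"
      moreover have "p j < n" "p (Suc j) < n" using permutes_in_image[OF p] j by auto
      ultimately show "bar_face G (Suc j) (map (g \<circ> (p \<circ> ?t)) [0..<n]) ! m
          = bar_face G (Suc j) (map (g \<circ> p) [0..<n]) ! m"
        using j by (auto simp: nth_bar_face comm transpose_def)
    qed simp
    \<comment> \<open>Reindexing by \<open>?t\<close> swaps the two merged entries. They commute, so
      the face is unchanged while the sign of the permutation flips.\<close>
    then have "S (Suc j) = - S (Suc j)"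
      unfolding S_def sum_negf[symmetric]
      by (subst sum_permutations_compose_right[OF t])
         (auto simp: sign_comp[OF _ t] sign_swap_id single_uminus intro!: sum.cong)
    then have "Poly_Mapping.lookup (S (Suc j)) y = - Poly_Mapping.lookup (S (Suc j)) y" for y
      by (metis lookup_uminus)
    then show ?thesis by (intro poly_mapping_eqI) simp
  qed
  have ends: "S 0 + S n = 0" if n: "n = Suc m" for m
  proof -
    have rot: "rotation m permutes {..<n}"
      using rotation(1)[of m] by (simp add: n lessThan_Suc_atMost)
    have face: "bar_face G n (map (g \<circ> (p \<circ> rotation m)) [0..<n]) = bar_face G 0 (map (g \<circ> p) [0..<n])" for p
      by (rule nth_equalityI) (auto simp: n nth_bar_face rotation_def simp del: upt_Suc)
    have flip: "(- 1) ^ m * (q * (- 1) ^ m) = q" for q :: rat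
      by (simp add: minus_one_power_iff)
    \<comment> \<open>The face index contributes \<open>(- 1) ^ n\<close> and the rotation
      \<open>(- 1) ^ m\<close>; with \<open>n = Suc m\<close> a single minus sign remains.\<close>
    have "S n = - S 0"
      unfolding S_def sum_negf[symmetric]
      by (subst sum_permutations_compose_right[OF rot])
         (auto simp: face[unfolded n] sign_comp[OF _ rot] rotation(2) n flip single_uminus
           simp del: upt_Suc intro!: sum.cong)
    then show ?thesis by simp
  qed
  have chain: "abelian_cycle n g \<in> bar_chains n G"
    unfolding abelian_cycle_def
  proof (rule bar_chains_sum, rule bar_chains_single)
    fix p assume "p \<in> {p. p permutes {..<n}}"
    then have "p k < n \<longleftrightarrow> k < n" for k using permutes_in_image[of p "{..<n}" k] by simp
    then show "set (map (g \<circ> p) [0..<n]) \<subseteq> carrier G" using g by auto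
  qed simp
  moreover have "bar_boundary n G (abelian_cycle n g) = 0"
  proof (cases n)
    case 0
    then show ?thesis by (simp add: bar_boundary_def)
  next
    case (Suc m)
    have "bar_boundary n G (abelian_cycle n g) = (\<Sum>j\<le>n. S j)"
      using Suc by (simp add: abelian_cycle_def S_def bar_boundary_sum bar_boundary_single
        sum.swap[of _ "{p. p permutes {..<Suc m}}"] del: sum.atMost_Suc upt_Suc)
    also have "\<dots> = S 0 + (\<Sum>j\<le>m. S (Suc j))"
      unfolding Suc by (rule sum.atMost_Suc_shift)
    also have "\<dots> = S 0 + S n + (\<Sum>j<m. S (Suc j))"
      by (simp add: Suc lessThan_Suc_atMost[symmetric] add_ac)
    also have "\<dots> = 0"
      using ends[OF Suc] mid Suc by simp
    finally show ?thesis .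
  qed
  ultimately show ?thesis by (simp add: bar_cycles_def)
qed

section \<open>A criterion for non-trivial Albanese homology\<close>

text \<open>The cup product of the homomorphisms induced on the abelianization vanishes on
  boundaries but equals 1 on the image of the abelian cycle, so this image is not a
  boundary.\<close>

theorem (in group) albanese_homology_nontrivial:
  assumes g: "\<And>k. k < n \<Longrightarrow> g k \<in> carrier G"
    and comm: "\<And>k l. k < n \<Longrightarrow> l < n \<Longrightarrow> g k \<otimes> g l = g l \<otimes> g k"
    and \<phi>: "\<And>k. k < n \<Longrightarrow> \<phi> k \<in> hom G integer_group"
    and dual: "\<And>k l. k < n \<Longrightarrow> l < n \<Longrightarrow> \<phi> k (g l) = (if k = l then 1 else 0)"
  shows "\<not> trivial_group (albanese_homology n G)"
proof
  assume triv: "trivial_group (albanese_homology n G)"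
  interpret ab: group_hom G "abelianization G" "abelianization_map G"
    by (rule group_hom_abelianization)
  have "\<exists>\<psi>. \<psi> \<in> hom (abelianization G) integer_group \<and>
      (\<forall>x\<in>carrier G. \<psi> (abelianization_map G x) = \<phi> k x)" if "k < n" for k
  proof -
    interpret h: group_hom G integer_group "\<phi> k"
      by (intro group_hom.intro group_hom_axioms.intro is_group group_integer_group \<phi> that)
    interpret Z: comm_group integer_group by (rule abelian_integer_group)
    \<comment> \<open>The integers are abelian, so \<open>\<phi> k\<close> kills the derived
      subgroup and factors through the abelianization.\<close>
    have "\<phi> k ` derived G (carrier G) = {\<one>\<^bsub>integer_group\<^esub>}"
      using h.derived_img[of "carrier G"] Z.derived_eq_singleton[of "\<phi> k ` carrier G"] by simp
    then have "derived G (carrier G) \<subseteq> kernel G integer_group (\<phi> k)"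
      using derived_in_carrier[of "carrier G"] by (fastforce simp: kernel_def)
    from h.FactGroup_universal_kernel[OF derived_self_is_normal this] show ?thesis
      unfolding abelianization_def abelianization_map_def by metis
  qed
  then obtain \<psi> where \<psi>: "\<And>k. k < n \<Longrightarrow> \<psi> k \<in> hom (abelianization G) integer_group"
    and \<psi>_eq: "\<And>k x. k < n \<Longrightarrow> x \<in> carrier G \<Longrightarrow> \<psi> k (abelianization_map G x) = \<phi> k x"
    by metis
  let ?c = "abelian_cycle n g" and ?A = "abelianization G"
  let ?d = "bar_map (abelianization_map G) ?c"
  have c: "?c \<in> bar_cycles n G" by (rule abelian_cycle_cycles[OF g comm])
  have "bar_boundaries n G #>\<^bsub>bar_cycle_group n G\<^esub> ?c \<in> carrier (group_homology n G)"
    using c by (auto simp: group_homology_def FactGroup_def RCOSETS_def bar_cycle_group_def)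
  then have "bar_boundaries n ?A #>\<^bsub>bar_cycle_group n ?A\<^esub> ?d \<in> carrier (albanese_homology n G)"
    unfolding albanese_homology_def by (simp add: ab.group_homology_map_coset[OF c, symmetric])
  then have coset: "bar_boundaries n ?A #>\<^bsub>bar_cycle_group n ?A\<^esub> ?d = bar_boundaries n ?A"
    using triv by (simp add: trivial_group_def albanese_homology_def group_homology_def)
  have "0 \<in> bar_boundaries n ?A"
    using normal_imp_subgroup[OF ab.H.bar_boundaries_normal[of n], THEN subgroup.one_closed]
    by (simp add: bar_cycle_group_def)
  \<comment> \<open>As \<open>0\<close> is a boundary, \<open>?d = 0 + ?d\<close> lies in its own
    coset, which is the set of boundaries.\<close>
  then have "?d \<in> bar_boundaries n ?A"
    by (subst coset[symmetric]) (force simp: r_coset_def bar_cycle_group_def)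
  then have "cup_eval n \<psi> ?d = 0" using cup_eval_boundaries[of n \<psi>, OF \<psi>] by blast
  moreover have "cup_eval n \<psi> ?d = 1"
    unfolding bar_map_abelian_cycle by (rule cup_eval_abelian_cycle) (simp add: \<psi>_eq g dual)
  ultimately show False by simp
qed


section \<open>Magnus coefficients under automorphisms trivial on the abelianization\<close>

text \<open>The coefficient of \<open>X\<^sub>a X\<^sub>b\<close> in the Magnus expansion \<open>s \<mapsto> 1 + X\<^sub>s\<close> of a word; the recursion
  is correct only for \<open>a \<noteq> b\<close>, as the term \<open>X\<^sub>a\<^sup>2\<close> in the inverse of \<open>1 + X\<^sub>a\<close> is ignored.\<close>

fun magnus :: "'a \<Rightarrow> 'a \<Rightarrow> ('a \<times> bool) list \<Rightarrow> int" where
  "magnus a b [] = 0"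
| "magnus a b (x # w) =
     (if fst x = a then (if snd x then 1 else - 1) else 0) * exponent_sum b w + magnus a b w"

text \<open>When a letter cancels its inverse, the two contributions have opposite signs; by
  \<open>a \<noteq> b\<close> the inner letter does not alter the exponent sum of \<open>b\<close>
  if its generator is \<open>a\<close>.\<close>

lemma magnus_push:
  assumes "a \<noteq> b"
  shows "magnus a b (push x w) =
    (if fst x = a then (if snd x then 1 else - 1) else 0) * exponent_sum b w + magnus a b w"
  using assms by (cases w) (auto simp: letter_inv_def)

text \<open>This is the product rule for power series, the linear Magnus coefficients being the
  exponent sums.\<close>

lemma magnus_foldr_push:
  assumes "a \<noteq> b"
  shows "magnus a b (foldr push u v) =
    magnus a b u + exponent_sum a u * exponent_sum b v + magnus a b v"
  by (induction u)
     (auto simp: magnus_push[OF assms] exponent_sum_foldr_push algebra_simps)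

text \<open>The kernel of the action of \<open>Aut(F\<^sub>n)\<close> on the abelianization, kept as
  a plain set because it only supplies coset representatives for \<open>IO n\<close>.\<close>

definition IA :: "nat \<Rightarrow> ((nat \<times> bool) list \<Rightarrow> (nat \<times> bool) list) set" where
  "IA n = {f \<in> auto (free_group {..<n}). abelianized_mat n f = 1\<^sub>m n}"

lemma IA_I:
  assumes "f \<in> auto (free_group {..<n})"
    and "\<And>i j. i < n \<Longrightarrow> j < n \<Longrightarrow> exponent_sum i (f [(j, True)]) = (if i = j then 1 else 0)"
  shows "f \<in> IA n"
  using assms by (auto simp: IA_def abelianized_mat_def intro!: eq_matI)

lemma exponent_sum_IA:
  assumes f: "f \<in> IA n" and i: "i < n" and w: "w \<in> carrier (free_group {..<n})"
  shows "exponent_sum i (f w) = exponent_sum i w"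
proof -
  have "exponent_sum i (f [(k, True)]) = (if i = k then 1 else 0)" if "k < n" for k
  proof -
    have "abelianized_mat n f $$ (i, k) = 1\<^sub>m n $$ (i, k)" using f by (simp add: IA_def)
    then show ?thesis using i that by (simp add: abelianized_mat_def)
  qed
  moreover have "exponent_sum i (f w) = (\<Sum>k<n. exponent_sum i (f [(k, True)]) * exponent_sum k w)"
    using f by (intro exponent_sum_hom_apply[OF _ w]) (simp add: IA_def auto_def)
  moreover have "(if i = k then 1 else 0) * exponent_sum k w = (if i = k then exponent_sum k w else 0)" for k
    by simp
  ultimately have "exponent_sum i (f w) = (\<Sum>k<n. if i = k then exponent_sum k w else 0)"
    by simp
  then show ?thesis using i by simp
qed

text \<open>Since \<open>f\<close> preserves exponent sums, the cross terms of the product rule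
  agree for \<open>f w\<close> and \<open>w\<close>. The difference of the two coefficients is thus
  a homomorphism in \<open>w\<close>, determined by its values on generators.\<close>

lemma magnus_IA:
  assumes f: "f \<in> IA n" and ab: "a < n" "b < n" "a \<noteq> b"
    and w: "w \<in> carrier (free_group {..<n})"
  shows "magnus a b (f w) =
    magnus a b w + (\<Sum>k<n. exponent_sum k w * magnus a b (f [(k, True)]))"
proof -
  let ?F = "free_group {..<n}"
  interpret F: group ?F by (rule group_free_group)
  have hom: "f \<in> hom ?F ?F" using f by (simp add: IA_def auto_def)
  have mult: "f (foldr push u v) = foldr push (f u) (f v)"
    if "u \<in> carrier ?F" "v \<in> carrier ?F" for u v
    using hom_mult[OF hom that] by (simp add: free_group_def)
  have "magnus a b (f w) - magnus a b w = (\<Sum>k<n. exponent_sum k w * magnus a b (f [(k, True)]))"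
  proof (rule free_group_hom_unique[OF group_integer_group _ _ _ w])
    show "(\<lambda>w. magnus a b (f w) - magnus a b w) \<in> hom ?F integer_group"
    proof (rule homI)
      fix u v assume uv: "u \<in> carrier ?F" "v \<in> carrier ?F"
      then have "u \<otimes>\<^bsub>?F\<^esub> v = foldr push u v" by (simp add: free_group_def)
      then show "magnus a b (f (u \<otimes>\<^bsub>?F\<^esub> v)) - magnus a b (u \<otimes>\<^bsub>?F\<^esub> v) =
          (magnus a b (f u) - magnus a b u) \<otimes>\<^bsub>integer_group\<^esub> (magnus a b (f v) - magnus a b v)"
        using uv ab by (simp add: mult magnus_foldr_push exponent_sum_IA[OF f])
    qed simp
    show "(\<lambda>w. \<Sum>k<n. exponent_sum k w * magnus a b (f [(k, True)])) \<in> hom ?F integer_group"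
      by (auto simp: hom_def free_group_def exponent_sum_foldr_push ring_distribs sum.distrib)
  next
    fix s assume "s \<in> {..<n}"
    then have "magnus a b (f [(s, True)]) =
        (\<Sum>k<n. if k = s then magnus a b (f [(k, True)]) else 0)"
      by simp
    also have "\<dots> = (\<Sum>k<n. exponent_sum k [(s, True)] * magnus a b (f [(k, True)]))"
      by (rule sum.cong) auto
    finally show "magnus a b (f [(s, True)]) - magnus a b [(s, True)] =
        (\<Sum>k<n. exponent_sum k [(s, True)] * magnus a b (f [(k, True)]))"
      by simp
  qed
  then show ?thesis by simp
qed

text \<open>The word \<open>g [(b, True)]\<close> has the exponent sums of the generator
  \<open>b\<close>, so only the summand \<open>k = b\<close> survives.\<close>

lemma magnus_IA_compose:
  assumes f: "f \<in> IA n" and g: "g \<in> IA n" and ab: "a < n" "b < n" "a \<noteq> b"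
  shows "magnus a b (compose (carrier (free_group {..<n})) f g [(b, True)]) =
    magnus a b (f [(b, True)]) + magnus a b (g [(b, True)])"
proof -
  let ?F = "free_group {..<n}"
  have "g [(b, True)] \<in> carrier ?F"
    using g ab by (auto simp: IA_def auto_def hom_def Pi_iff)
  then have "magnus a b (f (g [(b, True)])) = magnus a b (g [(b, True)])
      + (\<Sum>k<n. exponent_sum k (g [(b, True)]) * magnus a b (f [(k, True)]))"
    by (rule magnus_IA[OF f ab])
  also have "(\<Sum>k<n. exponent_sum k (g [(b, True)]) * magnus a b (f [(k, True)]))
      = (\<Sum>k<n. if k = b then magnus a b (f [(k, True)]) else 0)"
    using ab by (intro sum.cong) (auto simp: exponent_sum_IA[OF g])
  finally show ?thesis using ab by (simp add: compose_def)
qed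

text \<open>Comparison with the product rule for \<open>w\<close> times its inverse leaves only the
  cross term of \<open>w\<close> with the middle letter. The value does not depend on
  \<open>b\<close>, which lets differences of such coefficients vanish on inner
  automorphisms.\<close>

lemma magnus_Inn:
  assumes w: "w \<in> carrier (free_group S)" and ab: "a \<noteq> b"
  shows "magnus a b (w \<otimes>\<^bsub>free_group S\<^esub> [(b, True)] \<otimes>\<^bsub>free_group S\<^esub> inv\<^bsub>free_group S\<^esub> w) = exponent_sum a w"
proof -
  let ?F = "free_group S"
  interpret F: group ?F by (rule group_free_group)
  have mult: "u \<otimes>\<^bsub>?F\<^esub> v = foldr push u v" for u v by (simp add: free_group_def)
  have inv: "foldr push w (inv\<^bsub>?F\<^esub> w) = []"
    using F.r_inv[OF w] by (simp add: free_group_def)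
  have "exponent_sum b w + exponent_sum b (inv\<^bsub>?F\<^esub> w) = 0"
    using exponent_sum_foldr_push[of b w "inv\<^bsub>?F\<^esub> w"] by (simp add: inv)
  then have e: "exponent_sum b (inv\<^bsub>?F\<^esub> w) = - exponent_sum b w" by simp
  have "magnus a b w + exponent_sum a w * exponent_sum b (inv\<^bsub>?F\<^esub> w) + magnus a b (inv\<^bsub>?F\<^esub> w) = 0"
    using magnus_foldr_push[OF ab, of w "inv\<^bsub>?F\<^esub> w"] by (simp add: inv)
  then show ?thesis
    using ab unfolding mult
    by (simp only: magnus_foldr_push[OF ab] exponent_sum_foldr_push e)
       (simp add: algebra_simps)
qed

section \<open>Partial conjugations\<close>

definition conj_letter :: "nat \<Rightarrow> bool \<Rightarrow> nat \<times> bool \<Rightarrow> (nat \<times> bool) list" where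
  "conj_letter j b x = (if fst x = j then [(0, b), x, (0, \<not> b)] else [x])"

text \<open>The flag \<open>b\<close> selects \<open>x\<^sub>0\<close> or its inverse as conjugator,
  so that the inverse automorphism has the same form. Restriction to the carrier provides the
  extensionality required by \<open>auto\<close>.\<close>

definition partial_conj :: "nat \<Rightarrow> bool \<Rightarrow> nat \<Rightarrow> (nat \<times> bool) list \<Rightarrow> (nat \<times> bool) list" where
  "partial_conj n b j =
     (\<lambda>w\<in>carrier (free_group {..<n}). foldr (\<lambda>x. foldr push (conj_letter j b x)) w [])"

text \<open>Letterwise substitution respects cancellation, hence is multiplicative on reduced
  words.\<close>

lemma conj_letter_inverse:
  assumes "reduced v"
  shows "foldr push (conj_letter j b x) (foldr push (conj_letter j b (letter_inv x)) v) = v"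
proof -
  have "push (0, c) (push (0, \<not> c) w) = w" if "reduced w" for c and w :: "(nat \<times> bool) list"
    using push_push_inv[OF that, of "(0, c)"] by (simp add: letter_inv_def)
  from this[of _ True] this[of _ False] show ?thesis
    using assms by (cases b) (auto simp: conj_letter_def push_push_inv reduced_push)
qed

lemma reduced_foldr_conj_letter: "reduced (foldr (\<lambda>x. foldr push (conj_letter j b x)) w [])"
  by (induction w) (auto simp: reduced_foldr_push)

lemma foldr_conj_letter_push:
  "foldr (\<lambda>x. foldr push (conj_letter j b x)) (push x w) [] =
   foldr push (conj_letter j b x) (foldr (\<lambda>x. foldr push (conj_letter j b x)) w [])"
  by (cases w) (auto simp: conj_letter_inverse reduced_foldr_conj_letter)

lemma foldr_conj_letter_foldr_push:
  "foldr (\<lambda>x. foldr push (conj_letter j b x)) (foldr push u v) [] =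
   foldr push (foldr (\<lambda>x. foldr push (conj_letter j b x)) u [])
     (foldr (\<lambda>x. foldr push (conj_letter j b x)) v [])"
  by (induction u)
     (auto simp: foldr_conj_letter_push foldr_push_assoc reduced_foldr_conj_letter)

context
  fixes n :: nat
begin

interpretation F: group "free_group {..<n}" by (rule group_free_group)

lemma partial_conj_hom:
  assumes "j < n"
  shows "partial_conj n b j \<in> hom (free_group {..<n}) (free_group {..<n})"
proof (rule homI)
  fix u assume u: "u \<in> carrier (free_group {..<n})"
  have "fst ` set (foldr (\<lambda>x. foldr push (conj_letter j b x)) w []) \<subseteq> {..<n}"
    if "fst ` set w \<subseteq> {..<n}" for w
    using that
  proof (induction w)
    case (Cons x w)
    have "fst ` set (conj_letter j b x) \<subseteq> {..<n}"
      using Cons.prems assms by (auto simp: conj_letter_def)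
    then show ?case
      using Cons set_foldr_push[of "conj_letter j b x"] by fastforce
  qed simp
  then show "partial_conj n b j u \<in> carrier (free_group {..<n})"
    using u by (simp add: partial_conj_def free_group_def reduced_foldr_conj_letter)
next
  fix u v assume uv: "u \<in> carrier (free_group {..<n})" "v \<in> carrier (free_group {..<n})"
  then have "foldr push u v \<in> carrier (free_group {..<n})"
    using F.m_closed[OF uv] by (simp add: free_group_def)
  then show "partial_conj n b j (u \<otimes>\<^bsub>free_group {..<n}\<^esub> v) =
      partial_conj n b j u \<otimes>\<^bsub>free_group {..<n}\<^esub> partial_conj n b j v"
    using uv by (simp add: partial_conj_def free_group_def foldr_conj_letter_foldr_push)
qed

lemma partial_conj_generator:
  assumes "0 < j" "s < n"
  shows "partial_conj n b j [(s, True)] =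
    (if s = j then [(0, b), (j, True), (0, \<not> b)] else [(s, True)])"
  using assms by (auto simp: partial_conj_def conj_letter_def letter_inv_def)

text \<open>The argument is the value of a partial conjugation on the generator \<open>k\<close>, so
  this evaluates composites: \<open>k = j\<close> with opposite flags serves for inverses,
  \<open>k \<noteq> j\<close> for commutation.\<close>

lemma partial_conj_conjugate:
  assumes jk: "0 < j" "0 < k" "k < n"
  shows "partial_conj n b j [(0, c), (k, True), (0, \<not> c)] =
    (if k = j then if c = b then [(0, b), (0, b), (j, True), (0, \<not> b), (0, \<not> b)] else [(j, True)]
     else [(0, c), (k, True), (0, \<not> c)])"
proof -
  have "[(0, c), (k, True), (0, \<not> c)] \<in> carrier (free_group {..<n})"
    using jk by (auto simp: free_group_def reduced_def letter_inv_def)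
  then show ?thesis
    using jk by (auto simp: partial_conj_def conj_letter_def letter_inv_def)
qed

lemma free_group_endo_eqI:
  assumes "f \<in> hom (free_group {..<n}) (free_group {..<n})" "g \<in> hom (free_group {..<n}) (free_group {..<n})"
    and "\<And>s. s < n \<Longrightarrow> f [(s, True)] = g [(s, True)]"
    and "f \<in> extensional (carrier (free_group {..<n}))" "g \<in> extensional (carrier (free_group {..<n}))"
  shows "f = g"
proof (rule extensionalityI[OF assms(4,5)])
  fix w assume w: "w \<in> carrier (free_group {..<n})"
  show "f w = g w"
    by (rule free_group_hom_unique[OF F.is_group assms(1,2) _ w]) (simp add: assms(3))
qed

lemma partial_conj_inverse:
  assumes j: "0 < j" "j < n" and w: "w \<in> carrier (free_group {..<n})"
  shows "partial_conj n b j (partial_conj n (\<not> b) j w) = w"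
proof -
  let ?F = "free_group {..<n}"
  have "(\<lambda>w. partial_conj n b j (partial_conj n (\<not> b) j w)) \<in> hom ?F ?F"
    using hom_compose[OF partial_conj_hom[OF j(2)] partial_conj_hom[OF j(2)], of b "\<not> b"] by (simp add: comp_def)
  moreover have "(\<lambda>w. w) \<in> hom ?F ?F" by (simp add: hom_def)
  ultimately show ?thesis
    by (rule free_group_hom_unique[OF F.is_group _ _ _ w])
       (use j partial_conj_conjugate[of j j b "\<not> b"] in \<open>auto simp: partial_conj_generator\<close>)
qed

lemma partial_conj_auto:
  assumes j: "0 < j" "j < n"
  shows "partial_conj n b j \<in> auto (free_group {..<n})"
proof -
  let ?F = "free_group {..<n}"
  have closed: "partial_conj n c j w \<in> carrier ?F" if "w \<in> carrier ?F" for c w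
    using hom_carrier[OF partial_conj_hom[OF j(2)]] that by blast
  have "bij_betw (partial_conj n b j) (carrier ?F) (carrier ?F)"
    by (rule bij_betwI[where g = "partial_conj n (\<not> b) j"])
       (use closed partial_conj_inverse[OF j, of _ b] partial_conj_inverse[OF j, of _ "\<not> b"] in auto)
  then show ?thesis
    using partial_conj_hom[OF j(2)] by (simp add: auto_def Bij_def partial_conj_def)
qed

lemma partial_conj_IA:
  assumes "0 < j" "j < n"
  shows "partial_conj n b j \<in> IA n"
  using assms by (intro IA_I) (auto simp: partial_conj_auto partial_conj_generator)

text \<open>Both maps fix \<open>x\<^sub>0\<close>, and for \<open>j \<noteq> k\<close> each fixes
  the generator that the other conjugates, so the composites agree on generators.\<close>

lemma partial_conj_commute:
  assumes jk: "0 < j" "j < n" "0 < k" "k < n"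
  shows "partial_conj n True j \<otimes>\<^bsub>AutoGroup (free_group {..<n})\<^esub> partial_conj n True k =
    partial_conj n True k \<otimes>\<^bsub>AutoGroup (free_group {..<n})\<^esub> partial_conj n True j"
proof (cases "j = k")
  case False
  let ?F = "free_group {..<n}"
  have hom: "compose (carrier ?F) (partial_conj n True i) (partial_conj n True l) \<in> hom ?F ?F"
    if "0 < i" "i < n" "0 < l" "l < n" for i l
    using hom_compose[OF partial_conj_hom partial_conj_hom, of l i True True] that
    by (auto simp: hom_def compose_def Pi_iff)
  have "compose (carrier ?F) (partial_conj n True j) (partial_conj n True k) =
      compose (carrier ?F) (partial_conj n True k) (partial_conj n True j)"
    by (rule free_group_endo_eqI[OF hom hom])
       (use jk False partial_conj_conjugate[of j k True True] partial_conj_conjugate[of k j True True]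
        in \<open>auto simp: compose_def partial_conj_generator\<close>)
  then show ?thesis
    using jk by (simp add: AutoGroup_simps partial_conj_auto)
qed simp

end

section \<open>Homomorphisms from \<open>IO n\<close> to the integers\<close>

text \<open>Both coefficients take the value \<open>exponent_sum 0 w\<close> on conjugation by \<open>w\<close>, so that their
  difference descends to outer automorphisms.\<close>

definition IO_detect :: "nat \<Rightarrow> nat \<Rightarrow> ((nat \<times> bool) list \<Rightarrow> (nat \<times> bool) list) \<Rightarrow> int" where
  "IO_detect n j f = magnus 0 j (f [(j, True)]) - magnus 0 (n - 1) (f [(n - 1, True)])"

lemma IO_detect_compose:
  assumes "f \<in> IA n" "g \<in> IA n" "0 < j" "j < n"
  shows "IO_detect n j (f \<otimes>\<^bsub>AutoGroup (free_group {..<n})\<^esub> g) = IO_detect n j f + IO_detect n j g"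
proof -
  have "f \<otimes>\<^bsub>AutoGroup (free_group {..<n})\<^esub> g = compose (carrier (free_group {..<n})) f g"
    using assms by (simp add: IA_def AutoGroup_simps)
  then show ?thesis
    using assms by (simp add: IO_detect_def magnus_IA_compose)
qed

lemma Inn_IA: "Inn (free_group {..<n}) \<subseteq> IA n"
proof -
  interpret F: group "free_group {..<n}" by (rule group_free_group)
  have "Inn (free_group {..<n}) \<subseteq> carrier (AutoGroup (free_group {..<n}))"
    using normal_imp_subgroup[OF F.Inn_normal] by (rule subgroup.subset)
  then show ?thesis
    using abelianized_mat_Inn[of _ n] by (auto simp: IA_def AutoGroup_simps)
qed

lemma IO_detect_Inn:
  assumes f: "f \<in> Inn (free_group {..<n})" and j: "0 < j" "j < n"
  shows "IO_detect n j f = 0"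
  using assms magnus_Inn[of _ "{..<n}" 0] by (auto simp: IO_detect_def Inn_def)

text \<open>The matrix of a coset is that of any representative, so the kernel consists of the
  cosets of elements of \<open>IA n\<close>.\<close>

lemma IO_carrier:
  "carrier (IO n) = (\<lambda>f. Inn (free_group {..<n}) #>\<^bsub>AutoGroup (free_group {..<n})\<^esub> f) ` IA n"
proof -
  let ?F = "free_group {..<n}"
  have "carrier (IO n) =
      {C \<in> (\<lambda>f. Inn ?F #>\<^bsub>AutoGroup ?F\<^esub> f) ` auto ?F. Out_to_GL n C = 1\<^sub>m n}"
    by (auto simp: IO_def kernel_def Out_def FactGroup_def RCOSETS_def AutoGroup_simps(1)
      GL_int_def units_of_def ring_mat_simps)
  also have "\<dots> = (\<lambda>f. Inn ?F #>\<^bsub>AutoGroup ?F\<^esub> f) ` IA n"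
    using Out_to_GL_coset[of _ n] unfolding AutoGroup_simps(1) by (fastforce simp: IA_def)
  finally show ?thesis .
qed

text \<open>For \<open>0 < j\<close> and \<open>j < n\<close>, \<open>IO_detect n j\<close> is
  constant on each coset in \<open>IO n\<close>, so \<open>the_elem\<close> is applied to a
  singleton.\<close>

definition IO_functional :: "nat \<Rightarrow> nat \<Rightarrow> ((nat \<times> bool) list \<Rightarrow> (nat \<times> bool) list) set \<Rightarrow> int" where
  "IO_functional n j C = the_elem (IO_detect n j ` C)"

lemma IO_functional_coset:
  assumes f: "f \<in> IA n" and j: "0 < j" "j < n"
  shows "IO_functional n j (Inn (free_group {..<n}) #>\<^bsub>AutoGroup (free_group {..<n})\<^esub> f) = IO_detect n j f"
proof -
  let ?F = "free_group {..<n}"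
  interpret F: group ?F by (rule group_free_group)
  have "IO_detect n j (g \<otimes>\<^bsub>AutoGroup ?F\<^esub> f) = IO_detect n j f" if "g \<in> Inn ?F" for g
    using IO_detect_compose[OF subsetD[OF Inn_IA that] f j] IO_detect_Inn[OF that j] by simp
  then have "(\<lambda>g. IO_detect n j (g \<otimes>\<^bsub>AutoGroup ?F\<^esub> f)) ` Inn ?F = (\<lambda>g. IO_detect n j f) ` Inn ?F"
    by (rule image_cong[OF refl])
  also have "\<dots> = {IO_detect n j f}"
    by (rule image_constant[OF subgroup.one_closed[OF normal_imp_subgroup[OF F.Inn_normal]]])
  also have "(\<lambda>g. IO_detect n j (g \<otimes>\<^bsub>AutoGroup ?F\<^esub> f)) ` Inn ?F = IO_detect n j ` (Inn ?F #>\<^bsub>AutoGroup ?F\<^esub> f)"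
    unfolding r_coset_def by blast
  finally have "IO_detect n j ` (Inn ?F #>\<^bsub>AutoGroup ?F\<^esub> f) = {IO_detect n j f}" .
  then show ?thesis by (simp add: IO_functional_def)
qed

lemma IA_mult:
  assumes f: "f \<in> IA n" and g: "g \<in> IA n"
  shows "f \<otimes>\<^bsub>AutoGroup (free_group {..<n})\<^esub> g \<in> IA n"
proof -
  let ?F = "free_group {..<n}"
  interpret F: group ?F by (rule group_free_group)
  interpret A: group "AutoGroup ?F" by (rule F.AutoGroup)
  have fg: "f \<in> carrier (AutoGroup ?F)" "g \<in> carrier (AutoGroup ?F)"
    using f g by (simp_all add: IA_def AutoGroup_simps(1))
  have "abelianized_mat n (f \<otimes>\<^bsub>AutoGroup ?F\<^esub> g) = abelianized_mat n f * abelianized_mat n g"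
    using hom_mult[OF abelianized_mat_hom fg] by (simp add: GL_int_def units_of_def ring_mat_simps)
  also have "\<dots> = 1\<^sub>m n"
    using f g by (simp add: IA_def)
  finally show ?thesis
    using A.m_closed[OF fg] by (simp add: IA_def AutoGroup_simps(1))
qed

lemma IO_mult:
  assumes f: "f \<in> IA n" and g: "g \<in> IA n"
  shows "(Inn (free_group {..<n}) #>\<^bsub>AutoGroup (free_group {..<n})\<^esub> f) \<otimes>\<^bsub>IO n\<^esub>
      (Inn (free_group {..<n}) #>\<^bsub>AutoGroup (free_group {..<n})\<^esub> g) =
    Inn (free_group {..<n}) #>\<^bsub>AutoGroup (free_group {..<n})\<^esub> (f \<otimes>\<^bsub>AutoGroup (free_group {..<n})\<^esub> g)"
proof -
  interpret F: group "free_group {..<n}" by (rule group_free_group)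
  interpret N: normal "Inn (free_group {..<n})" "AutoGroup (free_group {..<n})" by (rule F.Inn_normal)
  show ?thesis
    using f g by (simp add: IO_def Out_def FactGroup_def N.rcos_sum IA_def AutoGroup_simps(1))
qed

lemma IO_functional_hom:
  assumes j: "0 < j" "j < n"
  shows "IO_functional n j \<in> hom (IO n) integer_group"
proof (rule homI)
  fix C D assume "C \<in> carrier (IO n)" "D \<in> carrier (IO n)"
  then obtain f g where "f \<in> IA n" "g \<in> IA n"
    and "C = Inn (free_group {..<n}) #>\<^bsub>AutoGroup (free_group {..<n})\<^esub> f"
    and "D = Inn (free_group {..<n}) #>\<^bsub>AutoGroup (free_group {..<n})\<^esub> g"
    unfolding IO_carrier by blast
  then show "IO_functional n j (C \<otimes>\<^bsub>IO n\<^esub> D) =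
      IO_functional n j C \<otimes>\<^bsub>integer_group\<^esub> IO_functional n j D"
    using j by (simp add: IO_mult IO_functional_coset IA_mult IO_detect_compose)
qed simp

text \<open>The bound \<open>l < n - 1\<close> keeps the reference generator fixed, so the
  subtracted coefficient is 0; the other one is read off from
  \<open>x\<^sub>0 x\<^sub>j x\<^sub>0\<inverse>\<close> if \<open>j = l\<close>.\<close>

lemma IO_detect_partial_conj:
  assumes "0 < j" "j < n - 1" "0 < l" "l < n - 1"
  shows "IO_detect n j (partial_conj n True l) = (if j = l then 1 else 0)"
  using assms by (simp add: IO_detect_def partial_conj_generator)

theorem corollary1p14:
  fixes i n :: nat
  assumes "i \<ge> 2"
    and "real n \<ge> real i + 2 + (1 - (- 1) ^ i) / 2"
  shows "\<not> trivial_group (albanese_homology i (IO n))"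
proof -
  have "(- 1 :: real) ^ i \<le> 1" by (simp add: minus_one_power_iff)
  \<comment> \<open>This makes room for the conjugator \<open>x\<^sub>0\<close>, the
    \<open>i\<close> conjugated generators and the reference generator with index
    \<open>n - 1\<close>.\<close>
  then have n: "n \<ge> i + 2" using assms(2) by (simp add: field_simps)
  let ?F = "free_group {..<n}"
  \<comment> \<open>The shift to \<open>Suc k\<close> skips the index 0 of the conjugator.\<close>
  define g where "g k = Inn ?F #>\<^bsub>AutoGroup ?F\<^esub> partial_conj n True (Suc k)" for k
  interpret IO: group "IO n" by (rule group_IO)
  have IA: "partial_conj n True (Suc k) \<in> IA n" if "k < i" for k
    using n that by (intro partial_conj_IA) auto
  show ?thesis
  proof (rule IO.albanese_homology_nontrivial)
    show "g k \<in> carrier (IO n)" if "k < i" for k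
      using IA that by (auto simp: g_def IO_carrier)
    show "g k \<otimes>\<^bsub>IO n\<^esub> g l = g l \<otimes>\<^bsub>IO n\<^esub> g k" if "k < i" "l < i" for k l
      unfolding g_def using n that
      by (simp add: IO_mult IA partial_conj_commute)
    show "IO_functional n (Suc k) \<in> hom (IO n) integer_group" if "k < i" for k
      using n that by (intro IO_functional_hom) auto
    show "IO_functional n (Suc k) (g l) = (if k = l then 1 else 0)" if "k < i" "l < i" for k l
      unfolding g_def using n that
      by (simp add: IO_functional_coset IA IO_detect_partial_conj)
  qed
qed

end
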